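(* Let $\mathbb{F}\in\{\mathbb{R},\mathbb{C}\}$, $p,q,r\in[1,\infty]$ and $l,m,n\in\mathbb{N}$. Then \[ \frac{1}{l^{|1/q-1/2|}\cdot m^{|1/p-1/2|}\cdot n^{|1/r-1/2|}}\le \lVert \mu_{l,m,n}\rVert_{p,q,r}, \] where $\lVert\mu_{l,m,n}\rVert_{p,q,r}\coloneqq\max_{X,Y,M\neq0}\frac{|\operatorname{tr}(XMY)|}{\|X\|_{p,q}\|Y\|_{q,r}\|M\|_{r,p}}$, the maximum being over nonzero $X\in\mathbb{F}^{l\times m}$, $M\in\mathbb{F}^{m\times n}$, $Y\in\mathbb{F}^{n\times l}$.
   Context: For a matrix $A\in\mathbb{F}^{a\times b}$ and $s,t\in[1,\infty]$, $\lVert A\rVert_{s,t}\coloneqq\max_{x\neq 0}\lVert Ax\rVert_t/\lVert x\rVert_s$, with $\lVert\cdot\rVert_s$ the vector $\ell^s$-norm. *)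

theory Defs
  imports "HOL-Analysis.Analysis"
begin

definition lp_norm :: "ereal \<Rightarrow> 'a::real_normed_vector ^ 'n \<Rightarrow> real" where
  "lp_norm s x =
    (if s = \<infinity> then Max (range (\<lambda>i. norm (x $ i)))
     else (\<Sum>i\<in>UNIV. norm (x $ i) powr real_of_ereal s) powr (1 / real_of_ereal s))"

(* The maxima below range over infinite sets, so Max does not apply; GREATEST denotes
   the maximum itself, i.e. the value that is attained and bounds all the others. *)

definition op_norm :: "ereal \<Rightarrow> ereal \<Rightarrow> 'a::real_normed_field ^ 'b ^ 'c \<Rightarrow> real" where
  "op_norm s t A = (GREATEST v. \<exists>x. x \<noteq> 0 \<and> v = lp_norm t (A *v x) / lp_norm s x)"

(* The sizes l, m, n are the cardinalities of finite index types; an l x m matrix over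
   the field 'a has type 'a ^ 'm ^ 'l. Field and sizes occur in no other argument,
   hence the itself parameters. *)

definition matmul_norm ::
  "'a::real_normed_field itself \<Rightarrow> 'l::finite itself \<Rightarrow> 'm::finite itself \<Rightarrow> 'n::finite itself
    \<Rightarrow> ereal \<Rightarrow> ereal \<Rightarrow> ereal \<Rightarrow> real" where
  "matmul_norm _ _ _ _ p q r =
    (GREATEST v. \<exists>(X :: 'a ^ 'm ^ 'l) (Y :: 'a ^ 'l ^ 'n) (M :: 'a ^ 'n ^ 'm).
       X \<noteq> 0 \<and> Y \<noteq> 0 \<and> M \<noteq> 0 \<and>
       v = norm (trace (X ** M ** Y)) / (op_norm p q X * op_norm q r Y * op_norm r p M))"

end

theory Submission imports Defs begin

text \<open>
  The bound is at most 1, since every size is at least 1 and every exponent is nonnegative.  On the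
  other hand, matrix units \<open>E\<^sub>i\<^sub>j\<close>, \<open>E\<^sub>j\<^sub>k\<close>, \<open>E\<^sub>k\<^sub>i\<close> have all operator norms equal to 1, and the
  trace of their product is 1, so the value 1 occurs in the maximum.  It remains to see that
  the maxima exist, which holds by homogeneity and compactness of unit spheres.
\<close>

section \<open>Continuity of maxima\<close>

lemma continuous_on_Max:
  fixes f :: "'i \<Rightarrow> 'a::topological_space \<Rightarrow> 'b::linorder_topology"
  assumes "finite I" "I \<noteq> {}" "\<And>i. i \<in> I \<Longrightarrow> continuous_on S (f i)"
  shows "continuous_on S (\<lambda>x. Max ((\<lambda>i. f i x) ` I))"
  using assms by (induction I rule: finite_ne_induct) (auto intro: continuous_on_max)

text \<open>By uniform continuity on the compact product, a small move of \<open>a\<close> changes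
  \<open>f a b\<close> by less than \<open>e\<close> for all \<open>b\<close> at once. Evaluating at
  a maximiser \<open>b\<close> for one point then bounds its maximum by that of the other plus
  \<open>e\<close>. Describing \<open>N\<close> by bounding and attainment lets functions defined
  through \<open>GREATEST\<close> take its place.\<close>

lemma continuous_on_max_over_compact:
  fixes f :: "'a::metric_space \<Rightarrow> 'b::metric_space \<Rightarrow> real"
  assumes "compact A" "compact B" and f: "continuous_on (A \<times> B) (\<lambda>(a, b). f a b)"
    and le: "\<And>a b. a \<in> A \<Longrightarrow> b \<in> B \<Longrightarrow> f a b \<le> N a"
    and att: "\<And>a. a \<in> A \<Longrightarrow> \<exists>b\<in>B. N a = f a b"
  shows "continuous_on A N"
proof -
  have uc: "uniformly_continuous_on (A \<times> B) (\<lambda>(a, b). f a b)"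
    using assms by (intro compact_uniformly_continuous compact_Times)
  show ?thesis
    unfolding continuous_on_iff
  proof (intro ballI allI impI)
    fix a and e :: real assume a: "a \<in> A" and "0 < e"
    then obtain d where "d > 0" and d: "\<And>z w. z \<in> A \<times> B \<Longrightarrow> w \<in> A \<times> B \<Longrightarrow> dist w z < d \<Longrightarrow>
        dist ((\<lambda>(a, b). f a b) w) ((\<lambda>(a, b). f a b) z) < e"
      using uc unfolding uniformly_continuous_on_def by meson
    have *: "N u < N v + e" if uv: "u \<in> A" "v \<in> A" "dist u v < d" for u v
    proof -
      obtain b where b: "b \<in> B" "N u = f u b" using att uv by blast
      \<comment> \<open>The two points of the product share the coordinate \<open>b\<close>, so
        their distance is that of \<open>u\<close> and \<open>v\<close>.\<close>
      have "dist (f u b) (f v b) < e"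
        using d[of "(v, b)" "(u, b)"] uv b by (simp add: dist_Pair_Pair)
      then show ?thesis using le[of v b] uv b by (simp add: dist_real_def)
    qed
    show "\<exists>d>0. \<forall>x'\<in>A. dist x' a < d \<longrightarrow> dist (N x') (N a) < e"
    proof (intro exI conjI ballI impI)
      fix x assume "x \<in> A" "dist x a < d"
      then show "dist (N x) (N a) < e"
        using *[of x a] *[of a x] a by (simp add: dist_real_def dist_commute abs_less_iff)
    qed fact
  qed
qed

section \<open>Vector norms\<close>

lemma lp_norm_infinity: "lp_norm \<infinity> x = Max (range (\<lambda>i. norm (x $ i)))"
  by (simp add: lp_norm_def)

text \<open>Mirrors the case split in \<open>lp_norm\<close>, replacing a finite exponent by a real
  number.\<close>

lemma ereal_ge_1_cases:
  fixes s :: ereal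
  assumes "1 \<le> s"
  obtains "s = \<infinity>" | e where "1 \<le> e" "s = ereal e"
  using assms by (cases s) (auto simp: one_ereal_def)

lemma continuous_on_lp_norm:
  fixes f :: "'b::topological_space \<Rightarrow> 'a::real_normed_vector ^ 'n"
  assumes "1 \<le> s" "continuous_on S f"
  shows "continuous_on S (\<lambda>x. lp_norm s (f x))"
  using assms(1)
proof (cases rule: ereal_ge_1_cases)
  case 1
  then show ?thesis
    using assms(2) by (auto simp: lp_norm_infinity intro!: continuous_on_Max continuous_intros)
next
  case (2 e)
  \<comment> \<open>The bases may vanish; \<open>powr\<close> is still continuous there because both
    exponents, \<open>e\<close> and \<open>1 / e\<close>, are positive.\<close>
  have "continuous_on S (\<lambda>x. (\<Sum>i\<in>UNIV. norm (f x $ i) powr e) powr (1 / e))"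
    using 2
    by (intro continuous_on_powr' continuous_on_sum continuous_on_norm continuous_on_component assms(2)
        continuous_on_const) (auto intro: sum_nonneg)
  then show ?thesis using 2 by (simp add: lp_norm_def)
qed

text \<open>This inequality yields both the positivity of the norm and the upper bound 1 for
  operator norms of matrix units.\<close>

lemma component_le_lp_norm:
  fixes x :: "'a::real_normed_vector ^ 'n"
  assumes "1 \<le> s"
  shows "norm (x $ i) \<le> lp_norm s x"
  using assms
proof (cases rule: ereal_ge_1_cases)
  case 1
  then show ?thesis by (simp add: lp_norm_infinity)
next
  case (2 e)
  have "norm (x $ i) = (norm (x $ i) powr e) powr (1 / e)"
    using 2 by (simp add: powr_powr)
  also have "\<dots> \<le> (\<Sum>i\<in>UNIV. norm (x $ i) powr e) powr (1 / e)"
    using 2 by (intro powr_mono2 member_le_sum) auto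
  finally show ?thesis using 2 by (simp add: lp_norm_def)
qed

lemma lp_norm_pos:
  assumes "1 \<le> s" "x \<noteq> 0"
  shows "0 < lp_norm s x"
proof -
  obtain i where "x $ i \<noteq> 0" using assms by (auto simp: vec_eq_iff)
  then show ?thesis
    using component_le_lp_norm[OF assms(1), of x i] by (smt (verit) zero_less_norm_iff)
qed

lemma lp_norm_axis:
  assumes "1 \<le> s"
  shows "lp_norm s (axis i c :: 'a::real_normed_vector ^ 'n) = norm c"
  using assms
proof (cases rule: ereal_ge_1_cases)
  case 1
  then show ?thesis
    by (auto simp: lp_norm_infinity axis_def intro!: Max_eqI)
next
  case (2 e)
  \<comment> \<open>Since \<open>0 powr e\<close> is 0, only position \<open>i\<close> contributes
    to the sum.\<close>
  have "norm ((axis i c :: 'a ^ 'n) $ j) powr e = (if j = i then norm c powr e else 0)" for j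
    using 2 by (simp add: axis_def)
  then show ?thesis using 2 by (simp add: lp_norm_def powr_powr)
qed

lemma lp_norm_scaleR:
  fixes x :: "'a::real_normed_vector ^ 'n"
  assumes "1 \<le> s"
  shows "lp_norm s (c *\<^sub>R x) = \<bar>c\<bar> * lp_norm s x"
  using assms
proof (cases rule: ereal_ge_1_cases)
  case 1
  have "mono (\<lambda>t. \<bar>c\<bar> * t)" by (auto simp: mono_def mult_left_mono)
  from mono_Max_commute[OF this, of "range (\<lambda>i. norm (x $ i))"] 1
  show ?thesis by (simp add: lp_norm_infinity image_image)
next
  case (2 e)
  have "(\<Sum>i\<in>UNIV. norm ((c *\<^sub>R x) $ i) powr e) = \<bar>c\<bar> powr e * (\<Sum>i\<in>UNIV. norm (x $ i) powr e)"
    by (simp add: powr_mult sum_distrib_left)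
  then show ?thesis using 2 by (simp add: lp_norm_def powr_mult powr_powr sum_nonneg)
qed

lemma lp_norm_eq_0_iff:
  fixes x :: "'a::real_normed_vector ^ 'n"
  shows "1 \<le> s \<Longrightarrow> lp_norm s x = 0 \<longleftrightarrow> x = 0"
  \<comment> \<open>Homogeneity with factor 0 gives the value at the zero vector.\<close>
  using lp_norm_pos[of s x] lp_norm_scaleR[of s 0 x] by (cases "x = 0") auto

section \<open>Matrix products and operator norms\<close>

lemma matrix_vector_mult_scaleR_right:
  fixes A :: "'a::real_normed_field ^ 'b ^ 'c"
  shows "A *v (k *\<^sub>R x) = k *\<^sub>R (A *v x)"
  by (simp add: matrix_vector_mult_def vec_eq_iff scaleR_sum_right)

lemma matrix_vector_mult_scaleR_left:
  fixes A :: "'a::real_normed_field ^ 'b ^ 'c"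
  shows "(k *\<^sub>R A) *v x = k *\<^sub>R (A *v x)"
  by (simp add: matrix_vector_mult_def vec_eq_iff scaleR_sum_right)

lemma continuous_on_matrix_vector_mult:
  fixes f :: "'d::topological_space \<Rightarrow> 'a::real_normed_field ^ 'b ^ 'c"
  assumes "continuous_on S f" "continuous_on S g"
  shows "continuous_on S (\<lambda>z. f z *v g z)"
  unfolding matrix_vector_mult_def using assms by (intro continuous_intros)

lemma continuous_on_matrix_matrix_mult:
  fixes f :: "'d::topological_space \<Rightarrow> 'a::real_normed_field ^ 'b ^ 'c"
  assumes "continuous_on S f" "continuous_on S g"
  shows "continuous_on S (\<lambda>z. f z ** g z)"
  unfolding matrix_matrix_mult_def using assms by (intro continuous_intros)

lemma continuous_on_trace:
  fixes f :: "'d::topological_space \<Rightarrow> 'a::real_normed_field ^ 'b ^ 'b"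
  assumes "continuous_on S f"
  shows "continuous_on S (\<lambda>z. trace (f z))"
  unfolding trace_def using assms by (intro continuous_intros)

text \<open>\<open>GREATEST\<close> denotes the intended value only once a maximum exists. The
  quotient is continuous on the compact Euclidean unit sphere, so it has a maximum there; being
  invariant under positive scaling, it takes no larger value at any other nonzero vector.\<close>

lemma op_norm_attained:
  fixes A :: "'a::{real_normed_field,euclidean_space} ^ 'b ^ 'c"
  assumes st: "1 \<le> s" "1 \<le> t"
  shows "\<exists>x\<in>sphere 0 1. op_norm s t A = lp_norm t (A *v x) / lp_norm s x"
    and "x \<noteq> 0 \<Longrightarrow> lp_norm t (A *v x) / lp_norm s x \<le> op_norm s t A"
proof -
  let ?f = "\<lambda>x. lp_norm t (A *v x) / lp_norm s x"
  have "continuous_on (sphere 0 1) ?f"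
    using st
    by (intro continuous_on_divide continuous_on_lp_norm continuous_on_matrix_vector_mult
        continuous_intros) (auto simp: lp_norm_eq_0_iff)
  then obtain z where z: "z \<in> sphere 0 1" and zmax: "\<And>y. y \<in> sphere 0 1 \<Longrightarrow> ?f y \<le> ?f z"
    using continuous_attains_sup[of "sphere 0 1" ?f] by auto
  have max: "?f x \<le> ?f z" if "x \<noteq> 0" for x
  proof -
    have "?f x = ?f ((1 / norm x) *\<^sub>R x)"
      using that st by (simp add: matrix_vector_mult_scaleR_right lp_norm_scaleR del: scaleR_scaleR)
    also have "\<dots> \<le> ?f z" using that by (intro zmax) simp
    finally show ?thesis .
  qed
  have "z \<noteq> 0" using z by auto
  then have "op_norm s t A = ?f z"
    unfolding op_norm_def using max by (intro Greatest_equality) auto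
  then show "\<exists>x\<in>sphere 0 1. op_norm s t A = ?f x" "x \<noteq> 0 \<Longrightarrow> ?f x \<le> op_norm s t A"
    using z max by auto
qed

lemma op_norm_pos:
  fixes A :: "'a::{real_normed_field,euclidean_space} ^ 'b ^ 'c"
  assumes st: "1 \<le> s" "1 \<le> t" and "A \<noteq> 0"
  shows "0 < op_norm s t A"
proof -
  obtain i j where "A $ i $ j \<noteq> 0" using \<open>A \<noteq> 0\<close> by (auto simp: vec_eq_iff)
  \<comment> \<open>The basis vector \<open>axis j 1\<close> picks out column \<open>j\<close>,
    which has a nonzero entry.\<close>
  moreover have "(A *v axis j 1) $ i = A $ i $ j"
    by (simp add: matrix_vector_mult_def axis_def if_distrib cong: if_cong)
  ultimately have "A *v axis j 1 \<noteq> 0" by (metis zero_index)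
  then have "0 < lp_norm t (A *v axis j 1) / lp_norm s (axis j 1 :: 'a ^ 'b)"
    using st by (simp add: lp_norm_pos lp_norm_axis)
  also have "\<dots> \<le> op_norm s t A"
    using st by (intro op_norm_attained(2)) (auto simp: axis_eq_0_iff)
  finally show ?thesis .
qed

text \<open>Every quotient is multiplied by \<open>\<bar>k\<bar>\<close>; each inequality follows by
  using a maximiser for its left side as a competitor on the right.\<close>

lemma op_norm_scaleR:
  fixes A :: "'a::{real_normed_field,euclidean_space} ^ 'b ^ 'c"
  assumes st: "1 \<le> s" "1 \<le> t"
  shows "op_norm s t (k *\<^sub>R A) = \<bar>k\<bar> * op_norm s t A"
proof (rule antisym)
  have e: "lp_norm t (k *\<^sub>R A *v x) / lp_norm s x = \<bar>k\<bar> * (lp_norm t (A *v x) / lp_norm s x)" for x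
    using st by (simp add: matrix_vector_mult_scaleR_left lp_norm_scaleR)
  obtain x where x: "norm x = 1" "op_norm s t (k *\<^sub>R A) = lp_norm t (k *\<^sub>R A *v x) / lp_norm s x"
    using op_norm_attained(1)[OF st] by (metis mem_sphere_0)
  have "x \<noteq> 0" using x by auto
  then show "op_norm s t (k *\<^sub>R A) \<le> \<bar>k\<bar> * op_norm s t A"
    unfolding x e by (intro mult_left_mono op_norm_attained(2) st) auto
  obtain y where y: "norm y = 1" "op_norm s t A = lp_norm t (A *v y) / lp_norm s y"
    using op_norm_attained(1)[OF st] by (metis mem_sphere_0)
  have "y \<noteq> 0" using y by auto
  then show "\<bar>k\<bar> * op_norm s t A \<le> op_norm s t (k *\<^sub>R A)"
    unfolding y e[symmetric] by (intro op_norm_attained(2) st)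
qed

lemma op_norm_eq_0_iff:
  fixes A :: "'a::{real_normed_field,euclidean_space} ^ 'b ^ 'c"
  shows "1 \<le> s \<Longrightarrow> 1 \<le> t \<Longrightarrow> op_norm s t A = 0 \<longleftrightarrow> A = 0"
  using op_norm_pos[of s t A] op_norm_scaleR[of s t 0 A] by (cases "A = 0") auto

text \<open>The operator norm is a maximum, over a unit sphere, of a quotient jointly continuous in
  matrix and vector. Confining the matrix to a sphere as well makes the parameter set
  compact.\<close>

lemma continuous_on_op_norm:
  assumes st: "1 \<le> s" "1 \<le> t"
  shows "continuous_on (sphere 0 1)
    (op_norm s t :: 'a::{real_normed_field,euclidean_space} ^ 'b ^ 'c \<Rightarrow> real)"
proof (rule continuous_on_max_over_compact)
  show "continuous_on (sphere 0 1 \<times> sphere 0 1)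
      (\<lambda>(A :: 'a ^ 'b ^ 'c, x). lp_norm t (A *v x) / lp_norm s x)"
    unfolding case_prod_unfold using st
    by (intro continuous_on_divide continuous_on_lp_norm continuous_on_matrix_vector_mult
        continuous_intros) (auto simp: lp_norm_eq_0_iff)
next
  fix A :: "'a ^ 'b ^ 'c" and x :: "'a ^ 'b" assume "x \<in> sphere 0 1"
  then have "x \<noteq> 0" by auto
  then show "lp_norm t (A *v x) / lp_norm s x \<le> op_norm s t A"
    by (rule op_norm_attained(2)[OF st])
qed (use op_norm_attained(1)[OF st] in simp_all)

section \<open>Existence of the maximum over matrix triples\<close>

lemma trace_mult_scaleR:
  fixes X :: "'a::real_normed_field ^ 'm ^ 'l" and M :: "'a ^ 'n ^ 'm" and Y :: "'a ^ 'l ^ 'n"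
  shows "trace ((a *\<^sub>R X) ** (b *\<^sub>R M) ** (c *\<^sub>R Y)) = (a * b * c) *\<^sub>R trace (X ** M ** Y)"
  by (simp add: trace_def matrix_matrix_mult_def scaleR_sum_right sum_distrib_left
      sum_distrib_right mult_ac)

text \<open>The quotient is unchanged when \<open>X\<close>, \<open>Y\<close> and \<open>M\<close>
  are separately scaled by positive factors, so its maximum over the compact product of three unit
  spheres bounds it on all nonzero triples. Thus the \<open>GREATEST\<close> in
  \<open>matmul_norm\<close> is a genuine maximum.\<close>

lemma matmul_norm_ge:
  fixes X :: "'a::{real_normed_field,euclidean_space} ^ 'm ^ 'l"
    and Y :: "'a ^ 'l ^ 'n" and M :: "'a ^ 'n ^ 'm"
  assumes pqr: "1 \<le> p" "1 \<le> q" "1 \<le> r" and ne: "X \<noteq> 0" "Y \<noteq> 0" "M \<noteq> 0"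
  shows "norm (trace (X ** M ** Y)) / (op_norm p q X * op_norm q r Y * op_norm r p M)
    \<le> matmul_norm TYPE('a) TYPE('l) TYPE('m) TYPE('n) p q r"
proof -
  let ?f = "\<lambda>(X :: 'a ^ 'm ^ 'l) (Y :: 'a ^ 'l ^ 'n) (M :: 'a ^ 'n ^ 'm).
    norm (trace (X ** M ** Y)) / (op_norm p q X * op_norm q r Y * op_norm r p M)"
  let ?S = "sphere (0 :: 'a ^ 'm ^ 'l) 1 \<times> sphere (0 :: 'a ^ 'l ^ 'n) 1 \<times> sphere (0 :: 'a ^ 'n ^ 'm) 1"
  have f: "continuous_on ?S (\<lambda>z. ?f (fst z) (fst (snd z)) (snd (snd z)))"
    by (intro continuous_on_divide continuous_on_norm continuous_on_mult continuous_on_trace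
        continuous_on_matrix_matrix_mult continuous_on_compose2[OF continuous_on_op_norm]
        continuous_intros pqr)
      (use pqr in \<open>auto simp: op_norm_eq_0_iff\<close>)
  have scale: "?f X Y M = ?f ((1 / norm X) *\<^sub>R X) ((1 / norm Y) *\<^sub>R Y) ((1 / norm M) *\<^sub>R M)"
    if "X \<noteq> 0" "Y \<noteq> 0" "M \<noteq> 0" for X Y M
    using that pqr by (simp add: trace_mult_scaleR op_norm_scaleR field_simps)
  \<comment> \<open>This point shows that \<open>?S\<close> is nonempty, as the existence of a
    maximum requires.\<close>
  have "((1 / norm X) *\<^sub>R X, (1 / norm Y) *\<^sub>R Y, (1 / norm M) *\<^sub>R M) \<in> ?S"
    using ne by simp
  then obtain z where z: "z \<in> ?S" and zmax: "\<And>w. w \<in> ?S \<Longrightarrow>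
      ?f (fst w) (fst (snd w)) (snd (snd w)) \<le> ?f (fst z) (fst (snd z)) (snd (snd z))"
    using continuous_attains_sup[OF _ _ f] by (metis compact_Times compact_sphere empty_iff)
  obtain X0 Y0 M0 where z0: "z = (X0, Y0, M0)" by (metis surj_pair)
  have max: "?f X Y M \<le> ?f X0 Y0 M0" if "X \<noteq> 0" "Y \<noteq> 0" "M \<noteq> 0" for X Y M
    unfolding scale[OF that]
    using zmax[of "((1 / norm X) *\<^sub>R X, (1 / norm Y) *\<^sub>R Y, (1 / norm M) *\<^sub>R M)"] that
    by (simp add: z0)
  have "X0 \<noteq> 0" "Y0 \<noteq> 0" "M0 \<noteq> 0" using z z0 by auto
  then have "matmul_norm TYPE('a) TYPE('l) TYPE('m) TYPE('n) p q r = ?f X0 Y0 M0"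
    unfolding matmul_norm_def using max by (intro Greatest_equality) blast+
  then show ?thesis using max ne by simp
qed

section \<open>Matrix units and the lower bound 1\<close>

definition matrix_unit :: "'c \<Rightarrow> 'b \<Rightarrow> 'a::real_normed_field ^ 'b ^ 'c" where
  "matrix_unit i j = axis i (axis j 1)"

lemma matrix_unit_mult_vector: "matrix_unit i j *v x = axis i (x $ j)"
proof -
  have "(if b = j then 1 else 0) * x $ b = (if b = j then x $ j else 0)" for b
    by simp
  then show ?thesis
    by (simp add: matrix_unit_def matrix_vector_mult_def vec_eq_iff axis_def)
qed

text \<open>Matrices are equal when they act equally on vectors; both sides send \<open>x\<close> to
  \<open>axis i (x $ k)\<close>.\<close>

lemma matrix_unit_mult: "matrix_unit i j ** matrix_unit j k = matrix_unit i k"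
  by (rule matrix_eq[THEN iffD2])
    (simp add: matrix_unit_mult_vector matrix_vector_mul_assoc[symmetric])

lemma trace_matrix_unit: "trace (matrix_unit i i :: 'a::real_normed_field ^ 'b ^ 'b) = 1"
proof -
  have "(matrix_unit i i :: 'a ^ 'b ^ 'b) $ j $ j = (if j = i then 1 else 0)" for j
    by (simp add: matrix_unit_def axis_def)
  then show ?thesis by (simp add: trace_def)
qed

text \<open>The quotient at \<open>x\<close> is \<open>norm (x $ j) / lp_norm s x\<close>: at most
  1, as no entry exceeds the norm, and equal to 1 at \<open>axis j 1\<close>.\<close>

lemma op_norm_matrix_unit:
  assumes st: "1 \<le> s" "1 \<le> t"
  shows "op_norm s t (matrix_unit i j :: 'a::real_normed_field ^ 'b ^ 'c) = 1"
  unfolding op_norm_def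
proof (rule Greatest_equality)
  show "\<exists>x. x \<noteq> 0 \<and> 1 = lp_norm t ((matrix_unit i j :: 'a ^ 'b ^ 'c) *v x) / lp_norm s x"
    using st by (intro exI[of _ "axis j 1"]) (simp add: matrix_unit_mult_vector lp_norm_axis axis_eq_0_iff)
next
  fix v assume "\<exists>x. x \<noteq> 0 \<and> v = lp_norm t ((matrix_unit i j :: 'a ^ 'b ^ 'c) *v x) / lp_norm s x"
  then show "v \<le> 1"
    using st by (auto simp: matrix_unit_mult_vector lp_norm_axis lp_norm_pos component_le_lp_norm)
qed

lemma one_le_matmul_norm:
  assumes pqr: "1 \<le> p" "1 \<le> q" "1 \<le> r"
  shows "1 \<le> matmul_norm TYPE('a::{real_normed_field,euclidean_space})
    TYPE('l::finite) TYPE('m::finite) TYPE('n::finite) p q r"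
proof -
  \<comment> \<open>Types are inhabited, so arbitrary indices can be fixed.\<close>
  obtain i :: 'l and j :: 'm and k :: 'n where True by simp
  let ?X = "matrix_unit i j :: 'a ^ 'm ^ 'l" and ?M = "matrix_unit j k :: 'a ^ 'n ^ 'm"
    and ?Y = "matrix_unit k i :: 'a ^ 'l ^ 'n"
  have "?X \<noteq> 0" "?M \<noteq> 0" "?Y \<noteq> 0" by (simp_all add: matrix_unit_def axis_eq_0_iff)
  \<comment> \<open>The reordering matches the order \<open>X\<close>, \<open>Y\<close>,
    \<open>M\<close> of the premises.\<close>
  from matmul_norm_ge[OF pqr this(1,3,2)] pqr show ?thesis
    by (simp add: matrix_unit_mult trace_matrix_unit op_norm_matrix_unit)
qed

theorem theorem4p3:
  fixes p q r :: ereal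
  assumes "1 \<le> p" and "1 \<le> q" and "1 \<le> r"
  shows "1 / (real CARD('l::finite) powr \<bar>real_of_ereal (1 / q) - 1 / 2\<bar> *
              real CARD('m::finite) powr \<bar>real_of_ereal (1 / p) - 1 / 2\<bar> *
              real CARD('n::finite) powr \<bar>real_of_ereal (1 / r) - 1 / 2\<bar>)
           \<le> matmul_norm TYPE(real) TYPE('l) TYPE('m) TYPE('n) p q r
       \<and> 1 / (real CARD('l) powr \<bar>real_of_ereal (1 / q) - 1 / 2\<bar> *
              real CARD('m) powr \<bar>real_of_ereal (1 / p) - 1 / 2\<bar> *
              real CARD('n) powr \<bar>real_of_ereal (1 / r) - 1 / 2\<bar>)
           \<le> matmul_norm TYPE(complex) TYPE('l) TYPE('m) TYPE('n) p q r"
proof -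
  have "1 / (real CARD('l) powr \<bar>real_of_ereal (1 / q) - 1 / 2\<bar> *
             real CARD('m) powr \<bar>real_of_ereal (1 / p) - 1 / 2\<bar> *
             real CARD('n) powr \<bar>real_of_ereal (1 / r) - 1 / 2\<bar>) \<le> 1" (is "1 / ?d \<le> 1")
  proof -
    \<comment> \<open>The left side is written as a product so that it compares with
      \<open>?d\<close> factor by factor.\<close>
    have "1 * 1 * 1 \<le> ?d"
      by (intro mult_mono ge_one_powr_ge_zero) (simp_all add: Suc_leI)
    then show ?thesis by simp
  qed
  then show ?thesis
    using one_le_matmul_norm[OF assms, where 'a = real and 'l = 'l and 'm = 'm and 'n = 'n]
      one_le_matmul_norm[OF assms, where 'a = complex and 'l = 'l and 'm = 'm and 'n = 'n]
    by linarith
qed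

end
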